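(* Let $\mathcal L:\mathcal H\to\mathcal H$ be the operator associated to the pair $(\mathcal U,\Lambda)$. Then for every $\lambda\in\mathbb C$ with $\lambda\notin\Lambda$, the resolvent of $\mathcal L$ is given by the formula $$\mathcal R(\lambda)f:=(\mathcal L-\lambda \mathrm I)^{-1}f=g_\lambda\star_{\mathcal U}f,\qquad f\in\mathcal H,$$ where $\mathrm I$ is the identity operator in $\mathcal H$ and $$g_\lambda=\sum_{\xi\in I}\frac{1}{\lambda_\xi-\lambda}\,u_\xi .$$
   Context: $\mathcal H$ is a separable complex Hilbert space with inner product $(\cdot,\cdot)$, linear in the first argument. $I$ is a discrete (countable) index set. $\mathcal U=\{u_\xi\}_{\xi\in I}$ is a Riesz basis of $\mathcal H$, and $\mathcal V=\{v_\xi\}_{\xi\in I}\subset\mathcal H$ is the system biorthogonal to $\mathcal U$: $(u_\xi,v_\eta)=\delta_{\xi\eta}$; then $\mathcal V$ is also a Riesz basis. $\Lambda=\{\lambda_\xi\}_{\xi\in I}$ is a fixed sequence of complex numbers such that $\sum_{\xi\in I}(1+|\lambda_\xi|)^{-s_0}<\infty$ for some $s_0>0$. The operator associated to the pair $(\mathcal U,\Lambda)$ is $\mathcal Lf:=\sum_{\xi\in I}\lambda_\xi(f,v_\xi)u_\xi$, with domain consisting of those $f\in\mathcal H$ for which the series converges in $\mathcal H$. Distributions: $\mathcal C^\infty_{\mathcal V,\Lambda}$ is the space of $\psi\in\mathcal H$ such that for every $k\in\{0,1,2,\dots\}$ there is $C$ with $|(\psi,u_\xi)|\le C(1+|\lambda_\xi|)^{-k}$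 for all $\xi\in I$, topologized by the seminorms $\sup_\xi(1+|\lambda_\xi|)^k|(\psi,u_\xi)|$; $\mathcal D'_{\mathcal U,\Lambda}$ is the space of continuous antilinear functionals on $\mathcal C^\infty_{\mathcal V,\Lambda}$, containing $\mathcal H$ via $\langle w,\psi\rangle=(w,\psi)$. For $w\in\mathcal D'_{\mathcal U,\Lambda}$ put $\widehat w(\xi)=\langle w,v_\xi\rangle$ (equal to $(w,v_\xi)$ if $w\in\mathcal H$). The series defining $g_\lambda$ is understood in $\mathcal D'_{\mathcal U,\Lambda}$ (weak-$*$ convergence), so $\widehat{g_\lambda}(\xi)=(\lambda_\xi-\lambda)^{-1}$. The $\mathcal U$-convolution is $g\star_{\mathcal U}f:=\sum_{\xi\in I}\widehat g(\xi)\widehat f(\xi)u_\xi$; for $g=g_\lambda$ and $f\in\mathcal H$ this series converges in $\mathcal H$. *)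

theory Defs
  imports "HOL-Analysis.Analysis"
begin

section \<open>Complex Hilbert spaces\<close>

text \<open>The inner product is linear in the first and antilinear in the second argument.\<close>

class complex_inner = real_normed_vector +
  fixes scaleC :: "complex \<Rightarrow> 'a \<Rightarrow> 'a"  (infixr \<open>*\<^sub>C\<close> 75)
    and cinner :: "'a \<Rightarrow> 'a \<Rightarrow> complex"
  assumes scaleC_add_right: "a *\<^sub>C (x + y) = a *\<^sub>C x + a *\<^sub>C y"
    and scaleC_add_left: "(a + b) *\<^sub>C x = a *\<^sub>C x + b *\<^sub>C x"
    and scaleC_scaleC: "a *\<^sub>C (b *\<^sub>C x) = (a * b) *\<^sub>C x"
    and scaleR_scaleC: "scaleR r x = complex_of_real r *\<^sub>C x"
    and cinner_commute: "cinner x y = cnj (cinner y x)"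
    and cinner_add_left: "cinner (x + y) w = cinner x w + cinner y w"
    and cinner_scaleC_left: "cinner (a *\<^sub>C x) y = a * cinner x y"
    and cinner_self: "cinner x x = complex_of_real ((norm x)\<^sup>2)"

class complex_hilbert = complex_inner + complete_space

instantiation complex :: complex_hilbert
begin

definition scaleC_complex :: "complex \<Rightarrow> complex \<Rightarrow> complex"
  where "scaleC_complex a x = a * x"

definition cinner_complex :: "complex \<Rightarrow> complex \<Rightarrow> complex"
  where "cinner_complex x y = x * cnj y"

instance
  by standard
    (simp_all add: scaleC_complex_def cinner_complex_def algebra_simps scaleR_conv_of_real
      complex_norm_square del: of_real_power)

end

global_interpretation complex_vector: vector_space "scaleC :: complex \<Rightarrow> 'a \<Rightarrow> 'a::complex_inner"
proof unfold_locales
  fix x :: 'a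
  show "1 *\<^sub>C x = x"
    using scaleR_scaleC[of 1 x] by simp
qed (simp_all add: scaleC_add_right scaleC_add_left scaleC_scaleC)

definition bounded_clinear :: "('a::complex_inner \<Rightarrow> 'b::complex_inner) \<Rightarrow> bool"
  where "bounded_clinear T \<longleftrightarrow> bounded_linear T \<and> (\<forall>c x. T (c *\<^sub>C x) = c *\<^sub>C T x)"


section \<open>Riesz bases\<close>

definition orthonormal_basis :: "'i set \<Rightarrow> ('i \<Rightarrow> 'a::complex_inner) \<Rightarrow> bool"
  where "orthonormal_basis I e \<longleftrightarrow>
    (\<forall>\<xi>\<in>I. \<forall>\<eta>\<in>I. cinner (e \<xi>) (e \<eta>) = (if \<xi> = \<eta> then 1 else 0)) \<and>
    closure (complex_vector.span (e ` I)) = UNIV"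

text \<open>A Riesz basis is the image of an orthonormal basis under a bounded linear operator with
  bounded inverse.\<close>

definition riesz_basis :: "'i set \<Rightarrow> ('i \<Rightarrow> 'a::complex_inner) \<Rightarrow> bool"
  where "riesz_basis I u \<longleftrightarrow>
    (\<exists>(e :: 'i \<Rightarrow> 'a) (T :: 'a \<Rightarrow> 'a) (S :: 'a \<Rightarrow> 'a).
      orthonormal_basis I e \<and> bounded_clinear T \<and> bounded_clinear S \<and>
      T \<circ> S = id \<and> S \<circ> T = id \<and> (\<forall>\<xi>\<in>I. u \<xi> = T (e \<xi>)))"

definition biorthogonal :: "'i set \<Rightarrow> ('i \<Rightarrow> 'a::complex_inner) \<Rightarrow> ('i \<Rightarrow> 'a) \<Rightarrow> bool"
  where "biorthogonal I u v \<longleftrightarrow>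
    (\<forall>\<xi>\<in>I. \<forall>\<eta>\<in>I. cinner (u \<xi>) (v \<eta>) = (if \<xi> = \<eta> then 1 else 0))"


section \<open>Resolvents of operators with a domain\<close>

text \<open>A possibly unbounded operator is given by its domain \<open>D\<close> and a function \<open>A\<close> whose values
  outside \<open>D\<close> are irrelevant.  The inverse in question is that of \<open>A - zI\<close> as a map from \<open>D\<close>
  onto the whole space.\<close>

definition resolvent :: "'a::complex_inner set \<Rightarrow> ('a \<Rightarrow> 'a) \<Rightarrow> complex \<Rightarrow> 'a \<Rightarrow> 'a"
  where "resolvent D A z = inv_into D (\<lambda>f. A f - z *\<^sub>C f)"

definition resolvent_set :: "'a::complex_inner set \<Rightarrow> ('a \<Rightarrow> 'a) \<Rightarrow> complex set"
  where "resolvent_set D A =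
    {z. bij_betw (\<lambda>f. A f - z *\<^sub>C f) D UNIV \<and> bounded_clinear (resolvent D A z)}"


section \<open>The operator associated to a pair\<close>

definition pair_domain ::
  "'i set \<Rightarrow> ('i \<Rightarrow> 'a::complex_inner) \<Rightarrow> ('i \<Rightarrow> 'a) \<Rightarrow> ('i \<Rightarrow> complex) \<Rightarrow> 'a set"
  where "pair_domain I u v \<Lambda> = {f. (\<lambda>\<xi>. (\<Lambda> \<xi> * cinner f (v \<xi>)) *\<^sub>C u \<xi>) summable_on I}"

definition pair_operator ::
  "'i set \<Rightarrow> ('i \<Rightarrow> 'a::complex_inner) \<Rightarrow> ('i \<Rightarrow> 'a) \<Rightarrow> ('i \<Rightarrow> complex) \<Rightarrow> 'a \<Rightarrow> 'a"
  where "pair_operator I u v \<Lambda> f = (\<Sum>\<^sub>\<infinity>\<xi>\<in>I. (\<Lambda> \<xi> * cinner f (v \<xi>)) *\<^sub>C u \<xi>)"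


section \<open>Test functions and distributions\<close>

definition test_space ::
  "'i set \<Rightarrow> ('i \<Rightarrow> 'a::complex_inner) \<Rightarrow> ('i \<Rightarrow> complex) \<Rightarrow> 'a set"
  where "test_space I u \<Lambda> =
    {\<psi>. \<forall>k::nat. \<exists>C::real. \<forall>\<xi>\<in>I. cmod (cinner \<psi> (u \<xi>)) \<le> C * inverse ((1 + cmod (\<Lambda> \<xi>)) ^ k)}"

definition test_seminorm ::
  "'i set \<Rightarrow> ('i \<Rightarrow> 'a::complex_inner) \<Rightarrow> ('i \<Rightarrow> complex) \<Rightarrow> nat \<Rightarrow> 'a \<Rightarrow> real"
  where "test_seminorm I u \<Lambda> k \<psi> = (SUP \<xi>\<in>I. (1 + cmod (\<Lambda> \<xi>)) ^ k * cmod (cinner \<psi> (u \<xi>)))"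

definition test_topology ::
  "'i set \<Rightarrow> ('i \<Rightarrow> 'a::complex_inner) \<Rightarrow> ('i \<Rightarrow> complex) \<Rightarrow> 'a topology"
  where "test_topology I u \<Lambda> = topology_generated_by
    {{\<psi> \<in> test_space I u \<Lambda>. test_seminorm I u \<Lambda> k (\<psi> - \<phi>) < \<epsilon>} | k \<phi> \<epsilon>.
      \<phi> \<in> test_space I u \<Lambda> \<and> 0 < \<epsilon>}"

text \<open>Functionals on the test space are represented by functions that are \<open>undefined\<close> outside of
  it, so that equality of distributions is equality of functions.\<close>

definition distributions ::
  "'i set \<Rightarrow> ('i \<Rightarrow> 'a::complex_inner) \<Rightarrow> ('i \<Rightarrow> complex) \<Rightarrow> ('a \<Rightarrow> complex) set"
  where "distributions I u \<Lambda> =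
    {w. w \<in> extensional (test_space I u \<Lambda>) \<and>
        (\<forall>\<phi>\<in>test_space I u \<Lambda>. \<forall>\<psi>\<in>test_space I u \<Lambda>. w (\<phi> + \<psi>) = w \<phi> + w \<psi>) \<and>
        (\<forall>c. \<forall>\<psi>\<in>test_space I u \<Lambda>. w (c *\<^sub>C \<psi>) = cnj c * w \<psi>) \<and>
        continuous_map (test_topology I u \<Lambda>) euclidean w}"

definition embed_distr ::
  "'i set \<Rightarrow> ('i \<Rightarrow> 'a::complex_inner) \<Rightarrow> ('i \<Rightarrow> complex) \<Rightarrow> 'a \<Rightarrow> 'a \<Rightarrow> complex"
  where "embed_distr I u \<Lambda> f = (\<lambda>\<psi>\<in>test_space I u \<Lambda>. cinner f \<psi>)"

definition weak_star_topology ::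
  "'i set \<Rightarrow> ('i \<Rightarrow> 'a::complex_inner) \<Rightarrow> ('i \<Rightarrow> complex) \<Rightarrow> ('a \<Rightarrow> complex) topology"
  where "weak_star_topology I u \<Lambda> =
    subtopology (product_topology (\<lambda>_. euclidean) (test_space I u \<Lambda>)) (distributions I u \<Lambda>)"

definition has_distr_sum ::
  "'i set \<Rightarrow> ('i \<Rightarrow> 'a::complex_inner) \<Rightarrow> ('i \<Rightarrow> complex) \<Rightarrow> ('i \<Rightarrow> complex) \<Rightarrow>
    ('a \<Rightarrow> complex) \<Rightarrow> bool"
  where "has_distr_sum I u \<Lambda> c w \<longleftrightarrow>
    limitin (weak_star_topology I u \<Lambda>)
      (\<lambda>F. embed_distr I u \<Lambda> (\<Sum>\<xi>\<in>F. c \<xi> *\<^sub>C u \<xi>)) w (finite_subsets_at_top I)"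

text \<open>The distribution \<open>g\<^sub>z\<close>, the weak-star sum of the series with coefficients
  \<open>1 / (\<Lambda> \<xi> - z)\<close>; it is well defined as soon as the series converges, since the weak-star
  topology is Hausdorff.\<close>

definition resolvent_kernel ::
  "'i set \<Rightarrow> ('i \<Rightarrow> 'a::complex_inner) \<Rightarrow> ('i \<Rightarrow> complex) \<Rightarrow> complex \<Rightarrow> 'a \<Rightarrow> complex"
  where "resolvent_kernel I u \<Lambda> z = (THE g. has_distr_sum I u \<Lambda> (\<lambda>\<xi>. 1 / (\<Lambda> \<xi> - z)) g)"

definition fourier_coeff :: "('i \<Rightarrow> 'a) \<Rightarrow> ('a \<Rightarrow> complex) \<Rightarrow> 'i \<Rightarrow> complex"
  where "fourier_coeff v w \<xi> = w (v \<xi>)"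

definition convolvable ::
  "'i set \<Rightarrow> ('i \<Rightarrow> 'a::complex_inner) \<Rightarrow> ('i \<Rightarrow> 'a) \<Rightarrow> ('a \<Rightarrow> complex) \<Rightarrow> ('a \<Rightarrow> complex) \<Rightarrow> bool"
  where "convolvable I u v g w \<longleftrightarrow>
    (\<lambda>\<xi>. (fourier_coeff v g \<xi> * fourier_coeff v w \<xi>) *\<^sub>C u \<xi>) summable_on I"

definition convolution ::
  "'i set \<Rightarrow> ('i \<Rightarrow> 'a::complex_inner) \<Rightarrow> ('i \<Rightarrow> 'a) \<Rightarrow> ('a \<Rightarrow> complex) \<Rightarrow> ('a \<Rightarrow> complex) \<Rightarrow> 'a"
  where "convolution I u v g w =
    (\<Sum>\<^sub>\<infinity>\<xi>\<in>I. (fourier_coeff v g \<xi> * fourier_coeff v w \<xi>) *\<^sub>C u \<xi>)"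

end

(* If u = T e for an orthonormal basis e and S is the inverse of T, then the expansion of S f along e,
   pushed forward by T, shows that (f, v_xi) = (S f, e_xi) and that f is the sum of (f, v_xi) u_xi.
   Hence a bounded multiplier acts boundedly on the coefficients (f, v_xi).  Summability of
   (1 + |lambda_xi|)^(-s0) leaves only finitely many lambda_xi in any disc, so (lambda_xi - z)^(-1) is
   a bounded multiplier; on coefficients it inverts multiplication by lambda_xi - z, which is L - z.
   The same summability makes the series of g_z converge against test functions, dominated by a
   single seminorm, and testing it on v_xi gives the coefficient (lambda_xi - z)^(-1). *)

theory Submission
  imports Defs
begin

section \<open>Complex inner product spaces\<close>

lemma cinner_zero_left [simp]: "cinner 0 (x::'a::complex_inner) = 0"
  using cinner_add_left[of 0 0 x] by simp

lemma cinner_diff_left: "cinner (x - y) (w::'a::complex_inner) = cinner x w - cinner y w"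
  using cinner_add_left[of "x - y" y w] by simp

lemma cinner_zero_right [simp]: "cinner (x::'a::complex_inner) 0 = 0"
  using cinner_commute[of x 0] by simp

lemma cinner_add_right: "cinner (w::'a::complex_inner) (x + y) = cinner w x + cinner w y"
  by (subst (1 2 3) cinner_commute) (simp add: cinner_add_left)

lemma cinner_diff_right: "cinner (w::'a::complex_inner) (x - y) = cinner w x - cinner w y"
  using cinner_add_right[of w "x - y" y] by simp

lemma cinner_scaleC_right: "cinner (x::'a::complex_inner) (a *\<^sub>C y) = cnj a * cinner x y"
  by (subst (1 2) cinner_commute) (simp add: cinner_scaleC_left)

lemma cinner_sum_left: "cinner (\<Sum>i\<in>F. g i) (w::'a::complex_inner) = (\<Sum>i\<in>F. cinner (g i) w)"
  by (induction F rule: infinite_finite_induct) (simp_all add: cinner_add_left)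

lemma cmod_cinner_commute: "cmod (cinner (x::'a::complex_inner) y) = cmod (cinner y x)"
  by (subst cinner_commute) simp

text \<open>The class axioms tie the norm to real scalars only; for complex ones it is recovered
  from \<open>cinner_self\<close> by comparing squares.\<close>

lemma norm_scaleC: "norm (a *\<^sub>C (x::'a::complex_inner)) = cmod a * norm x"
proof -
  have "complex_of_real ((norm (a *\<^sub>C x))\<^sup>2) = a * cnj a * cinner x x"
    by (simp add: cinner_self[symmetric] cinner_scaleC_left cinner_scaleC_right del: of_real_power)
  also have "\<dots> = complex_of_real ((cmod a * norm x)\<^sup>2)"
    unfolding cinner_self complex_norm_square[symmetric] by (simp add: power_mult_distrib)
  finally show ?thesis
    by (simp only: of_real_eq_iff) (auto intro: power2_eq_imp_eq)
qed

text \<open>The squared norm of the part of \<open>x\<close> orthogonal to \<open>y\<close> is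
  nonnegative.\<close>

lemma cinner_Cauchy_Schwarz: "cmod (cinner x y) \<le> norm x * norm (y::'a::complex_inner)"
proof (cases "y = 0")
  case False
  \<comment> \<open>\<open>c\<close> is the coefficient of the orthogonal projection of
    \<open>x\<close> onto the line spanned by \<open>y\<close>.\<close>
  define c where "c = cinner x y / cinner y y"
  have "cinner y y \<noteq> 0" using False by (simp add: cinner_self)
  then have "cinner (x - c *\<^sub>C y) y = 0"
    by (simp add: cinner_diff_left cinner_scaleC_left c_def)
  then have "cinner (x - c *\<^sub>C y) (x - c *\<^sub>C y) = cinner x x - c * cinner y x"
    by (subst cinner_diff_right) (simp add: cinner_scaleC_right cinner_diff_left cinner_scaleC_left)
  also have "c * cinner y x = (cinner x y * cnj (cinner x y)) / complex_of_real ((norm y)\<^sup>2)"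
    unfolding c_def cinner_self by (simp add: cinner_commute[of y x])
  also have "\<dots> = complex_of_real ((cmod (cinner x y))\<^sup>2 / (norm y)\<^sup>2)"
    unfolding complex_norm_square[symmetric] by simp
  also have "cinner x x - \<dots> = complex_of_real ((norm x)\<^sup>2 - (cmod (cinner x y))\<^sup>2 / (norm y)\<^sup>2)"
    unfolding cinner_self by simp
  finally have "complex_of_real ((norm (x - c *\<^sub>C y))\<^sup>2) =
      complex_of_real ((norm x)\<^sup>2 - (cmod (cinner x y))\<^sup>2 / (norm y)\<^sup>2)"
    by (simp only: cinner_self)
  then have "0 \<le> (norm x)\<^sup>2 - (cmod (cinner x y))\<^sup>2 / (norm y)\<^sup>2"
    by (metis of_real_eq_iff zero_le_power2)
  then have "(cmod (cinner x y))\<^sup>2 \<le> (norm x * norm y)\<^sup>2"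
    using False by (simp add: field_simps power_mult_distrib)
  then show ?thesis by (rule power2_le_imp_le) simp
qed simp

lemma bounded_linear_cinner_left: "bounded_linear (\<lambda>x. cinner x (y::'a::complex_inner))"
  \<comment> \<open>\<open>scaleR_scaleC\<close> also rewrites the real scaling in the target
    \<open>complex\<close>, hence \<open>scaleC_complex_def\<close>.\<close>
  by (rule bounded_linear_intro[where K = "norm y"])
    (simp_all add: cinner_add_left scaleR_scaleC cinner_scaleC_left cinner_Cauchy_Schwarz
      scaleC_complex_def)

lemma bounded_linear_scaleC_right: "bounded_linear (\<lambda>x::'a::complex_inner. c *\<^sub>C x)"
  by (rule bounded_linear_intro[where K = "cmod c"])
    (simp_all add: scaleC_add_right scaleR_scaleC norm_scaleC mult.commute)

text \<open>Conjugation moves \<open>y\<close> into the linear argument, where continuity is known.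
  This lets orthogonality pass from a span to its closure.\<close>

lemma closed_cinner_eq_0: "closed {y. cinner (x::'a::complex_inner) y = 0}"
proof -
  have "{y. cinner x y = 0} = (\<lambda>y. cinner y x) -` {0}"
    using cinner_commute[of x] by fastforce
  moreover have "continuous_on UNIV (\<lambda>y. cinner y x)"
    by (rule linear_continuous_on[OF bounded_linear_cinner_left])
  ultimately show ?thesis
    by (simp add: closed_vimage)
qed

section \<open>Cauchy criterion for unordered sums\<close>

instance complex_hilbert \<subseteq> banach ..

text \<open>Orthogonal series with square-summable coefficients need not converge absolutely, so
  convergence is drawn from completeness: sums over finite sets containing \<open>F0\<close> all lie
  close to the sum over \<open>F0\<close>.\<close>

lemma summable_on_norm_Cauchy:
  fixes f :: "'i \<Rightarrow> 'a::banach"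
  assumes "\<And>\<epsilon>. \<epsilon> > 0 \<Longrightarrow> \<exists>F0. finite F0 \<and> F0 \<subseteq> A \<and> (\<forall>F. finite F \<longrightarrow> F \<subseteq> A - F0 \<longrightarrow> norm (sum f F) < \<epsilon>)"
  shows "f summable_on A"
proof -
  have "cauchy_filter (filtermap (sum f) (finite_subsets_at_top A))"
    unfolding cauchy_filter_metric_filtermap
  proof (intro allI impI)
    fix \<epsilon> :: real assume "\<epsilon> > 0"
    then obtain F0 where F0: "finite F0" "F0 \<subseteq> A"
      and small: "\<And>F. finite F \<Longrightarrow> F \<subseteq> A - F0 \<Longrightarrow> norm (sum f F) < \<epsilon> / 2"
      using assms[of "\<epsilon> / 2"] by (metis half_gt_zero)
    define P where "P F \<longleftrightarrow> finite F \<and> F0 \<subseteq> F \<and> F \<subseteq> A" for F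
    have near: "dist (sum f F) (sum f F0) < \<epsilon> / 2" if "P F" for F
      using small[of "F - F0"] that F0
      by (simp add: P_def dist_norm sum_diff Diff_mono)
    have "dist (sum f F) (sum f F') < \<epsilon>" if "P F" "P F'" for F F'
      using near[OF that(1)] near[OF that(2)] by (rule dist_triangle_half_l)
    moreover have "eventually P (finite_subsets_at_top A)"
      unfolding eventually_finite_subsets_at_top P_def using F0 by blast
    ultimately show "\<exists>P. eventually P (finite_subsets_at_top A) \<and>
        (\<forall>x y. P x \<and> P y \<longrightarrow> dist (sum f x) (sum f y) < \<epsilon>)"
      by blast
  qed
  moreover have "filtermap (sum f) (finite_subsets_at_top A) \<noteq> bot"
    by (simp add: filtermap_bot_iff)
  ultimately obtain x where "filtermap (sum f) (finite_subsets_at_top A) \<le> nhds x"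
    using cauchy_filter_complete_converges[OF _ complete_UNIV,
        of "filtermap (sum f) (finite_subsets_at_top A)"] by auto
  then show ?thesis
    by (auto simp: summable_on_def has_sum_def filterlim_def)
qed


section \<open>Expansions in Riesz bases\<close>

text \<open>Pairing with \<open>v \<eta>\<close> is continuous, so it can be done term by term, and
  one term survives. Taking \<open>v = u = e\<close> covers orthonormal bases.\<close>

lemma biorthogonal_coefficient:
  assumes "biorthogonal I u v" and "((\<lambda>\<xi>. a \<xi> *\<^sub>C u \<xi>) has_sum f) I" and "\<eta> \<in> I"
  shows "cinner f (v \<eta>) = a \<eta>"
proof -
  have "((\<lambda>\<xi>. cinner (a \<xi> *\<^sub>C u \<xi>) (v \<eta>)) has_sum cinner f (v \<eta>)) I"
    by (rule has_sum_bounded_linear[OF bounded_linear_cinner_left assms(2)])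
  moreover have "cinner (a \<xi> *\<^sub>C u \<xi>) (v \<eta>) = (if \<xi> = \<eta> then a \<eta> else 0)" if "\<xi> \<in> I" for \<xi>
    using assms(1,3) that by (simp add: biorthogonal_def cinner_scaleC_left)
  ultimately have "((\<lambda>\<xi>. if \<xi> = \<eta> then a \<eta> else 0) has_sum cinner f (v \<eta>)) I"
    by (simp cong: has_sum_cong)
  moreover have "((\<lambda>\<xi>. if \<xi> = \<eta> then a \<eta> else 0) has_sum a \<eta>) I"
    using assms(3) by (intro has_sum_finite_neutralI[of "{\<eta>}"]) auto
  ultimately show ?thesis
    by (rule has_sum_unique)
qed

section \<open>Orthonormal bases and bounded multipliers\<close>

lemma orthonormal_basis_biorthogonal: "orthonormal_basis I e \<Longrightarrow> biorthogonal I e e"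
  by (simp add: orthonormal_basis_def biorthogonal_def)

text \<open>Pythagoras.\<close>

lemma orthonormal_norm_sum:
  assumes "orthonormal_basis I e" and "finite F" and "F \<subseteq> I"
  shows "(norm (\<Sum>\<xi>\<in>F. a \<xi> *\<^sub>C e \<xi>))\<^sup>2 = (\<Sum>\<xi>\<in>F. (cmod (a \<xi>))\<^sup>2)"
proof -
  define h where "h = (\<Sum>\<xi>\<in>F. a \<xi> *\<^sub>C e \<xi>)"
  \<comment> \<open>Extension by zero turns the finite sum into a series over \<open>I\<close>, so
    that its coefficients can be read off.\<close>
  have "((\<lambda>\<xi>. (if \<xi> \<in> F then a \<xi> else 0) *\<^sub>C e \<xi>) has_sum h) I"
    using assms(2,3) by (intro has_sum_finite_neutralI[of F]) (auto simp: h_def)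
  then have coeff: "cinner h (e \<xi>) = a \<xi>" if "\<xi> \<in> F" for \<xi>
    using biorthogonal_coefficient[OF orthonormal_basis_biorthogonal[OF assms(1)], of _ h \<xi>]
      that assms(3) by auto
  have "complex_of_real ((norm h)\<^sup>2) = (\<Sum>\<xi>\<in>F. a \<xi> * cinner (e \<xi>) h)"
    unfolding cinner_self[symmetric] by (subst h_def) (simp add: cinner_sum_left cinner_scaleC_left)
  also have "\<dots> = (\<Sum>\<xi>\<in>F. a \<xi> * cnj (a \<xi>))"
    by (rule sum.cong[OF refl], subst cinner_commute) (simp add: coeff)
  also have "\<dots> = complex_of_real (\<Sum>\<xi>\<in>F. (cmod (a \<xi>))\<^sup>2)"
    by (simp add: complex_norm_square[symmetric] del: of_real_power)
  finally show ?thesis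
    by (simp only: of_real_eq_iff h_def)
qed

text \<open>The convergence half of Riesz-Fischer: by Pythagoras, the Cauchy criterion for the
  vectors is the one for the squared coefficients.\<close>

lemma orthonormal_series_summable:
  fixes e :: "'i \<Rightarrow> 'a::complex_hilbert"
  assumes "orthonormal_basis I e" and "(\<lambda>\<xi>. (cmod (a \<xi>))\<^sup>2) summable_on I"
  shows "(\<lambda>\<xi>. a \<xi> *\<^sub>C e \<xi>) summable_on I"
proof (rule summable_on_norm_Cauchy)
  fix \<epsilon> :: real assume "\<epsilon> > 0"
  define L where "L = (\<Sum>\<^sub>\<infinity>\<xi>\<in>I. (cmod (a \<xi>))\<^sup>2)"
  obtain F0 where F0: "finite F0" "F0 \<subseteq> I" and near: "dist (\<Sum>\<xi>\<in>F0. (cmod (a \<xi>))\<^sup>2) L \<le> \<epsilon>\<^sup>2 / 2"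
    using infsum_finite_approximation[OF assms(2), of "\<epsilon>\<^sup>2 / 2"] \<open>\<epsilon> > 0\<close> by (auto simp: L_def)
  have "norm (\<Sum>\<xi>\<in>F. a \<xi> *\<^sub>C e \<xi>) < \<epsilon>" if F: "finite F" "F \<subseteq> I - F0" for F
  proof -
    \<comment> \<open>The sum over \<open>F0\<close> is already within half of the squared tolerance
      of \<open>L\<close>, and adding \<open>F\<close> cannot exceed \<open>L\<close>.\<close>
    have "(\<Sum>\<xi>\<in>F0 \<union> F. (cmod (a \<xi>))\<^sup>2) \<le> L"
      unfolding L_def by (rule finite_sum_le_infsum[OF assms(2)]) (use F F0 in auto)
    moreover have "(\<Sum>\<xi>\<in>F0 \<union> F. (cmod (a \<xi>))\<^sup>2) =
        (\<Sum>\<xi>\<in>F0. (cmod (a \<xi>))\<^sup>2) + (\<Sum>\<xi>\<in>F. (cmod (a \<xi>))\<^sup>2)"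
      using F F0 by (intro sum.union_disjoint) auto
    ultimately have "(\<Sum>\<xi>\<in>F. (cmod (a \<xi>))\<^sup>2) < \<epsilon>\<^sup>2"
      using near \<open>\<epsilon> > 0\<close> zero_less_power[of \<epsilon> 2] unfolding dist_real_def by linarith
    moreover have "F \<subseteq> I"
      using F(2) by blast
    ultimately have "(norm (\<Sum>\<xi>\<in>F. a \<xi> *\<^sub>C e \<xi>))\<^sup>2 < \<epsilon>\<^sup>2"
      by (simp add: orthonormal_norm_sum[OF assms(1) F(1)])
    then show ?thesis
      using \<open>\<epsilon> > 0\<close> by (simp add: power_less_imp_less_base)
  qed
  then show "\<exists>F0. finite F0 \<and> F0 \<subseteq> I \<and>
      (\<forall>F. finite F \<longrightarrow> F \<subseteq> I - F0 \<longrightarrow> norm (\<Sum>\<xi>\<in>F. a \<xi> *\<^sub>C e \<xi>) < \<epsilon>)"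
    using F0 by blast
qed

text \<open>For the projection \<open>p\<close> of \<open>h\<close>, the squared norm equals
  \<open>cinner p h\<close>; Cauchy-Schwarz then allows one factor \<open>norm p\<close> to be
  cancelled.\<close>

lemma Bessel_inequality:
  assumes "orthonormal_basis I e" and "finite F" and "F \<subseteq> I"
  shows "(\<Sum>\<xi>\<in>F. (cmod (cinner h (e \<xi>)))\<^sup>2) \<le> (norm h)\<^sup>2"
proof -
  define p where "p = (\<Sum>\<xi>\<in>F. cinner h (e \<xi>) *\<^sub>C e \<xi>)"
  have pp: "(norm p)\<^sup>2 = (\<Sum>\<xi>\<in>F. (cmod (cinner h (e \<xi>)))\<^sup>2)"
    unfolding p_def by (rule orthonormal_norm_sum[OF assms])
  have "cinner p h = (\<Sum>\<xi>\<in>F. cinner h (e \<xi>) * cnj (cinner h (e \<xi>)))"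
    unfolding p_def cinner_sum_left cinner_scaleC_left
    by (rule sum.cong[OF refl], subst (2) cinner_commute) simp
  also have "\<dots> = complex_of_real ((norm p)\<^sup>2)"
    unfolding pp by (simp add: complex_norm_square[symmetric] del: of_real_power)
  finally have "(norm p)\<^sup>2 = cmod (cinner p h)"
    by (simp only: norm_of_real abs_power2)
  also have "\<dots> \<le> norm p * norm h"
    by (rule cinner_Cauchy_Schwarz)
  finally have "norm p \<le> norm h"
    by (cases "p = 0") (simp_all add: power2_eq_square)
  then have "(norm p)\<^sup>2 \<le> (norm h)\<^sup>2"
    by (simp add: power_mono)
  then show ?thesis by (simp only: pp)
qed

text \<open>Here the density of the span enters: the vectors orthogonal to \<open>h\<close> form a
  closed subspace containing the basis, hence also \<open>h\<close> itself.\<close>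

lemma orthonormal_basis_eq_zeroI:
  assumes "orthonormal_basis I e" and "\<And>\<xi>. \<xi> \<in> I \<Longrightarrow> cinner h (e \<xi>) = 0"
  shows "h = 0"
proof -
  have "complex_vector.span (e ` I) \<subseteq> {y. cinner h y = 0}"
    by (rule complex_vector.span_minimal)
      (auto simp: assms(2) complex_vector.subspace_def cinner_add_right cinner_scaleC_right)
  then have "closure (complex_vector.span (e ` I)) \<subseteq> {y. cinner h y = 0}"
    by (rule closure_minimal[OF _ closed_cinner_eq_0])
  then have "cinner h h = 0"
    using assms(1) by (auto simp: orthonormal_basis_def)
  then show ?thesis by (simp add: cinner_self)
qed

text \<open>Bessel's inequality with weights at most the square of \<open>M\<close>. The absolute
  value covers empty \<open>I\<close>, where \<open>M\<close> may be negative.\<close>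

lemma orthonormal_multiplier_summable:
  fixes e :: "'i \<Rightarrow> 'a::complex_hilbert"
  assumes "orthonormal_basis I e" and "\<And>\<xi>. \<xi> \<in> I \<Longrightarrow> cmod (m \<xi>) \<le> M"
  shows "(\<lambda>\<xi>. (m \<xi> * cinner h (e \<xi>)) *\<^sub>C e \<xi>) summable_on I"
    and "norm (\<Sum>\<^sub>\<infinity>\<xi>\<in>I. (m \<xi> * cinner h (e \<xi>)) *\<^sub>C e \<xi>) \<le> \<bar>M\<bar> * norm h"
proof -
  have bound: "(\<Sum>\<xi>\<in>F. (cmod (m \<xi> * cinner h (e \<xi>)))\<^sup>2) \<le> (\<bar>M\<bar> * norm h)\<^sup>2"
    if F: "finite F" "F \<subseteq> I" for F
  proof -
    have "(\<Sum>\<xi>\<in>F. (cmod (m \<xi> * cinner h (e \<xi>)))\<^sup>2) \<le> (\<Sum>\<xi>\<in>F. M\<^sup>2 * (cmod (cinner h (e \<xi>)))\<^sup>2)"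
    proof (rule sum_mono)
      fix \<xi> assume "\<xi> \<in> F"
      then have "(cmod (m \<xi>))\<^sup>2 \<le> M\<^sup>2"
        using assms(2) F(2) by (intro power_mono) auto
      then show "(cmod (m \<xi> * cinner h (e \<xi>)))\<^sup>2 \<le> M\<^sup>2 * (cmod (cinner h (e \<xi>)))\<^sup>2"
        by (simp add: norm_mult power_mult_distrib mult_right_mono)
    qed
    also have "\<dots> \<le> M\<^sup>2 * (norm h)\<^sup>2"
      using Bessel_inequality[OF assms(1) F] by (simp add: sum_distrib_left[symmetric] mult_left_mono)
    finally show ?thesis by (simp add: power_mult_distrib)
  qed
  have "(\<lambda>\<xi>. (cmod (m \<xi> * cinner h (e \<xi>)))\<^sup>2) summable_on I"
    by (rule nonneg_bdd_above_summable_on) (use bound in \<open>auto intro!: bdd_aboveI2\<close>)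
  then show summ: "(\<lambda>\<xi>. (m \<xi> * cinner h (e \<xi>)) *\<^sub>C e \<xi>) summable_on I"
    by (rule orthonormal_series_summable[OF assms(1)])
  have "norm (\<Sum>\<xi>\<in>F. (m \<xi> * cinner h (e \<xi>)) *\<^sub>C e \<xi>) \<le> \<bar>M\<bar> * norm h"
    if F: "finite F" "F \<subseteq> I" for F
    by (rule power2_le_imp_le) (use bound[OF F] orthonormal_norm_sum[OF assms(1) F] in auto)
  then have "\<forall>\<^sub>F F in finite_subsets_at_top I.
      norm (\<Sum>\<xi>\<in>F. (m \<xi> * cinner h (e \<xi>)) *\<^sub>C e \<xi>) \<le> \<bar>M\<bar> * norm h"
    by (simp add: eventually_finite_subsets_at_top_weakI)
  with tendsto_norm[OF infsum_tendsto[OF summ]]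
  show "norm (\<Sum>\<^sub>\<infinity>\<xi>\<in>I. (m \<xi> * cinner h (e \<xi>)) *\<^sub>C e \<xi>) \<le> \<bar>M\<bar> * norm h"
    by (rule tendsto_upperbound) simp
qed

text \<open>Linearity of \<open>R\<close> follows from uniqueness of sums, boundedness from the norm
  estimate above.\<close>

lemma orthonormal_multiplier:
  fixes e :: "'i \<Rightarrow> 'a::complex_hilbert"
  assumes "orthonormal_basis I e" and "\<And>\<xi>. \<xi> \<in> I \<Longrightarrow> cmod (m \<xi>) \<le> M"
  obtains R :: "'a \<Rightarrow> 'a" where "bounded_clinear R"
    and "\<And>h. ((\<lambda>\<xi>. (m \<xi> * cinner h (e \<xi>)) *\<^sub>C e \<xi>) has_sum R h) I"
proof
  define R where "R h = (\<Sum>\<^sub>\<infinity>\<xi>\<in>I. (m \<xi> * cinner h (e \<xi>)) *\<^sub>C e \<xi>)" for h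
  show sums: "((\<lambda>\<xi>. (m \<xi> * cinner h (e \<xi>)) *\<^sub>C e \<xi>) has_sum R h) I" for h
    unfolding R_def by (rule has_sum_infsum[OF orthonormal_multiplier_summable(1)[OF assms]])
  have add: "R (x + y) = R x + R y" for x y
    using has_sum_add[OF sums[of x] sums[of y]]
    by (intro has_sum_unique[OF sums])
      (simp add: cinner_add_left scaleC_add_left distrib_left)
  have scale: "R (c *\<^sub>C x) = c *\<^sub>C R x" for c x
    using has_sum_bounded_linear[OF bounded_linear_scaleC_right[of c] sums[of x]]
    by (intro has_sum_unique[OF sums])
      (simp add: cinner_scaleC_left scaleC_scaleC mult.left_commute)
  have "bounded_linear R"
    by (rule bounded_linear_intro[where K = "\<bar>M\<bar>"])
      (use add scale orthonormal_multiplier_summable(2)[OF assms] in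
        \<open>auto simp: scaleR_scaleC R_def mult.commute\<close>)
  then show "bounded_clinear R"
    using scale by (simp add: bounded_clinear_def)
qed

text \<open>The multiplier 1 gives convergence to some \<open>p\<close>; then \<open>h - p\<close>
  has only zero coefficients.\<close>

lemma orthonormal_basis_expansion:
  fixes e :: "'i \<Rightarrow> 'a::complex_hilbert"
  assumes "orthonormal_basis I e"
  shows "((\<lambda>\<xi>. cinner h (e \<xi>) *\<^sub>C e \<xi>) has_sum h) I"
proof -
  have "(\<lambda>\<xi>. (1 * cinner h (e \<xi>)) *\<^sub>C e \<xi>) summable_on I"
    by (rule orthonormal_multiplier_summable(1)[OF assms, where M = 1]) simp
  then obtain p where p: "((\<lambda>\<xi>. cinner h (e \<xi>) *\<^sub>C e \<xi>) has_sum p) I"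
    by (auto simp: summable_on_def)
  have "h - p = 0"
    using biorthogonal_coefficient[OF orthonormal_basis_biorthogonal[OF assms] p]
    by (intro orthonormal_basis_eq_zeroI[OF assms]) (simp add: cinner_diff_left)
  then show ?thesis using p by simp
qed

section \<open>Transfer to Riesz bases\<close>

text \<open>\<open>T\<close> maps the orthonormal expansion of \<open>S f\<close> to an expansion of
  \<open>f\<close> along \<open>u\<close>; biorthogonality identifies its coefficients, so
  \<open>v\<close> need not be described through an adjoint of \<open>S\<close>.\<close>

lemma riesz_basis_expansion:
  fixes u v :: "'i \<Rightarrow> 'a::complex_hilbert"
  assumes "riesz_basis I u" and "biorthogonal I u v"
  shows "((\<lambda>\<xi>. cinner f (v \<xi>) *\<^sub>C u \<xi>) has_sum f) I"
proof -
  obtain e :: "'i \<Rightarrow> 'a" and T S :: "'a \<Rightarrow> 'a" where e: "orthonormal_basis I e" and T: "bounded_clinear T"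
    and TS: "T \<circ> S = id" and u: "\<forall>\<xi>\<in>I. u \<xi> = T (e \<xi>)"
    using assms(1) unfolding riesz_basis_def by blast
  have "((\<lambda>\<xi>. T (cinner (S f) (e \<xi>) *\<^sub>C e \<xi>)) has_sum T (S f)) I"
    by (rule has_sum_bounded_linear[OF _ orthonormal_basis_expansion[OF e]])
      (use T in \<open>simp add: bounded_clinear_def\<close>)
  then have "((\<lambda>\<xi>. T (cinner (S f) (e \<xi>) *\<^sub>C e \<xi>)) has_sum f) I"
    using TS by (metis comp_apply id_apply)
  then have exp: "((\<lambda>\<xi>. cinner (S f) (e \<xi>) *\<^sub>C u \<xi>) has_sum f) I"
    using T u by (simp add: bounded_clinear_def cong: has_sum_cong)
  then show ?thesis
    using biorthogonal_coefficient[OF assms(2) exp] by (simp cong: has_sum_cong)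
qed

text \<open>The multiplier along \<open>u\<close> is the one along \<open>e\<close> conjugated by
  \<open>T\<close>.\<close>

lemma riesz_basis_multiplier:
  fixes u v :: "'i \<Rightarrow> 'a::complex_hilbert"
  assumes "riesz_basis I u" and "biorthogonal I u v" and "\<And>\<xi>. \<xi> \<in> I \<Longrightarrow> cmod (m \<xi>) \<le> M"
  obtains R :: "'a \<Rightarrow> 'a" where "bounded_clinear R"
    and "\<And>f. ((\<lambda>\<xi>. (m \<xi> * cinner f (v \<xi>)) *\<^sub>C u \<xi>) has_sum R f) I"
proof -
  obtain e :: "'i \<Rightarrow> 'a" and T S :: "'a \<Rightarrow> 'a" where e: "orthonormal_basis I e" and T: "bounded_clinear T" and S: "bounded_clinear S"
    and ST: "S \<circ> T = id" and u: "\<forall>\<xi>\<in>I. u \<xi> = T (e \<xi>)"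
    using assms(1) unfolding riesz_basis_def by blast
  obtain R where R: "bounded_clinear R"
    and sums: "\<And>h. ((\<lambda>\<xi>. (m \<xi> * cinner h (e \<xi>)) *\<^sub>C e \<xi>) has_sum R h) I"
    using orthonormal_multiplier[OF e, where m = m, OF assms(3)] by blast
  have "((\<lambda>\<xi>. S (cinner f (v \<xi>) *\<^sub>C u \<xi>)) has_sum S f) I" for f
    by (rule has_sum_bounded_linear[OF _ riesz_basis_expansion[OF assms(1,2)]])
      (use S in \<open>simp add: bounded_clinear_def\<close>)
  moreover have "S (T x) = x" for x
    using ST by (metis comp_apply id_apply)
  ultimately have "((\<lambda>\<xi>. cinner f (v \<xi>) *\<^sub>C e \<xi>) has_sum S f) I" for f
    using S u by (simp add: bounded_clinear_def cong: has_sum_cong)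
  \<comment> \<open>Both families of coefficients belong to the same expansion of \<open>S f\<close>
    along \<open>e\<close>.\<close>
  then have coeff: "cinner (S f) (e \<xi>) = cinner f (v \<xi>)" if "\<xi> \<in> I" for f \<xi>
    using biorthogonal_coefficient[OF orthonormal_basis_biorthogonal[OF e],
        of "\<lambda>\<xi>. cinner f (v \<xi>)" "S f"] that by blast
  show ?thesis
  proof
    show "bounded_clinear (T \<circ> R \<circ> S)"
      using T R S unfolding bounded_clinear_def comp_def by (auto intro: bounded_linear_compose)
    fix f
    have "((\<lambda>\<xi>. T ((m \<xi> * cinner (S f) (e \<xi>)) *\<^sub>C e \<xi>)) has_sum T (R (S f))) I"
      by (rule has_sum_bounded_linear[OF _ sums]) (use T in \<open>simp add: bounded_clinear_def\<close>)
    then show "((\<lambda>\<xi>. (m \<xi> * cinner f (v \<xi>)) *\<^sub>C u \<xi>) has_sum (T \<circ> R \<circ> S) f) I"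
      unfolding comp_apply using T u coeff by (simp add: bounded_clinear_def cong: has_sum_cong)
  qed
qed

section \<open>The operator of the pair and its inverse\<close>

lemma pair_operator_coefficient:
  assumes "biorthogonal I u v" and "f \<in> pair_domain I u v \<Lambda>" and "\<eta> \<in> I"
  shows "cinner (pair_operator I u v \<Lambda> f) (v \<eta>) = \<Lambda> \<eta> * cinner f (v \<eta>)"
  by (rule biorthogonal_coefficient[OF assms(1) _ assms(3)])
    (use assms(2) in \<open>simp add: pair_domain_def pair_operator_def\<close>)

lemma riesz_basis_eqI:
  fixes u v :: "'i \<Rightarrow> 'a::complex_hilbert"
  assumes "riesz_basis I u" and "biorthogonal I u v"
    and "\<And>\<xi>. \<xi> \<in> I \<Longrightarrow> cinner f (v \<xi>) = cinner g (v \<xi>)"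
  shows "f = g"
proof (rule has_sum_unique)
  show "((\<lambda>\<xi>. cinner g (v \<xi>) *\<^sub>C u \<xi>) has_sum g) I"
    by (rule riesz_basis_expansion[OF assms(1,2)])
  show "((\<lambda>\<xi>. cinner g (v \<xi>) *\<^sub>C u \<xi>) has_sum f) I"
    using riesz_basis_expansion[OF assms(1,2), of f] assms(3) by (simp cong: has_sum_cong)
qed

text \<open>On each coefficient the map is multiplication by the nonzero number
  \<open>\<Lambda> \<xi> - z\<close>, and coefficients determine the vector.\<close>

lemma inj_on_pair_operator:
  fixes u v :: "'i \<Rightarrow> 'a::complex_hilbert"
  assumes "riesz_basis I u" and "biorthogonal I u v" and "z \<notin> \<Lambda> ` I"
  shows "inj_on (\<lambda>f. pair_operator I u v \<Lambda> f - z *\<^sub>C f) (pair_domain I u v \<Lambda>)"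
proof (rule inj_onI, rule riesz_basis_eqI[OF assms(1,2)])
  fix f g \<xi>
  assume fg: "f \<in> pair_domain I u v \<Lambda>" "g \<in> pair_domain I u v \<Lambda>"
    and eq: "pair_operator I u v \<Lambda> f - z *\<^sub>C f = pair_operator I u v \<Lambda> g - z *\<^sub>C g"
    and \<xi>: "\<xi> \<in> I"
  have "cinner (pair_operator I u v \<Lambda> h - z *\<^sub>C h) (v \<xi>) = (\<Lambda> \<xi> - z) * cinner h (v \<xi>)"
    if "h \<in> pair_domain I u v \<Lambda>" for h
    using pair_operator_coefficient[OF assms(2) that \<xi>]
    by (simp add: cinner_diff_left cinner_scaleC_left left_diff_distrib)
  then have "(\<Lambda> \<xi> - z) * cinner f (v \<xi>) = (\<Lambda> \<xi> - z) * cinner g (v \<xi>)"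
    using fg eq by metis
  then show "cinner f (v \<xi>) = cinner g (v \<xi>)"
    using assms(3) \<xi> by auto
qed

text \<open>Since \<open>\<Lambda> \<xi> / (\<Lambda> \<xi> - z) = 1 + z / (\<Lambda> \<xi> -
  z)\<close>, the series defining the operator at \<open>g\<close> is the expansion of
  \<open>f\<close> plus \<open>z\<close> times the given series. Its convergence is the membership
  in the domain.\<close>

lemma pair_operator_right_inverse:
  fixes u v :: "'i \<Rightarrow> 'a::complex_hilbert"
  assumes "riesz_basis I u" and "biorthogonal I u v" and "z \<notin> \<Lambda> ` I"
    and "((\<lambda>\<xi>. (1 / (\<Lambda> \<xi> - z) * cinner f (v \<xi>)) *\<^sub>C u \<xi>) has_sum g) I"
  shows "g \<in> pair_domain I u v \<Lambda>" and "pair_operator I u v \<Lambda> g - z *\<^sub>C g = f"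
proof -
  have coeff: "\<Lambda> \<xi> * cinner g (v \<xi>) = cinner f (v \<xi>) + z * (1 / (\<Lambda> \<xi> - z) * cinner f (v \<xi>))"
    if "\<xi> \<in> I" for \<xi>
  proof -
    have "\<Lambda> \<xi> - z \<noteq> 0" using assms(3) that by auto
    then show ?thesis
      using biorthogonal_coefficient[OF assms(2,4) that] by (simp add: field_simps)
  qed
  have "((\<lambda>\<xi>. cinner f (v \<xi>) *\<^sub>C u \<xi> + z *\<^sub>C ((1 / (\<Lambda> \<xi> - z) * cinner f (v \<xi>)) *\<^sub>C u \<xi>))
      has_sum f + z *\<^sub>C g) I"
    by (intro has_sum_add riesz_basis_expansion[OF assms(1,2)]
        has_sum_bounded_linear[OF bounded_linear_scaleC_right assms(4)])
  then have "((\<lambda>\<xi>. (\<Lambda> \<xi> * cinner g (v \<xi>)) *\<^sub>C u \<xi>) has_sum f + z *\<^sub>C g) I"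
    using coeff by (simp add: scaleC_add_left scaleC_scaleC cong: has_sum_cong)
  then show "g \<in> pair_domain I u v \<Lambda>" and "pair_operator I u v \<Lambda> g - z *\<^sub>C g = f"
    by (auto simp: pair_domain_def pair_operator_def has_sum_imp_summable infsumI)
qed

text \<open>The multiplier \<open>R\<close> is a right inverse with values in the domain;
  injectivity makes \<open>inv_into\<close> agree with it, so the resolvent inherits boundedness and
  the series.\<close>

lemma pair_operator_resolvent:
  fixes u v :: "'i \<Rightarrow> 'a::complex_hilbert"
  assumes "riesz_basis I u" and "biorthogonal I u v" and "z \<notin> \<Lambda> ` I"
    and "\<And>\<xi>. \<xi> \<in> I \<Longrightarrow> cmod (1 / (\<Lambda> \<xi> - z)) \<le> M"
  shows "z \<in> resolvent_set (pair_domain I u v \<Lambda>) (pair_operator I u v \<Lambda>)"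
    and "((\<lambda>\<xi>. (1 / (\<Lambda> \<xi> - z) * cinner f (v \<xi>)) *\<^sub>C u \<xi>) has_sum
      resolvent (pair_domain I u v \<Lambda>) (pair_operator I u v \<Lambda>) z f) I"
proof -
  define D A where "D = pair_domain I u v \<Lambda>" and "A = (\<lambda>f. pair_operator I u v \<Lambda> f - z *\<^sub>C f)"
  obtain R :: "'a \<Rightarrow> 'a" where R: "bounded_clinear R"
    and sums: "\<And>f. ((\<lambda>\<xi>. (1 / (\<Lambda> \<xi> - z) * cinner f (v \<xi>)) *\<^sub>C u \<xi>) has_sum R f) I"
    using riesz_basis_multiplier[OF assms(1,2), where m = "\<lambda>\<xi>. 1 / (\<Lambda> \<xi> - z)", OF assms(4)] by blast
  have RD: "R f \<in> D" and AR: "A (R f) = f" for f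
    using pair_operator_right_inverse[OF assms(1-3) sums] by (simp_all add: D_def A_def)
  have inj: "inj_on A D"
    unfolding A_def D_def by (rule inj_on_pair_operator[OF assms(1-3)])
  have "A ` D = UNIV"
    using RD AR by (metis UNIV_eq_I image_eqI)
  moreover have "resolvent D (pair_operator I u v \<Lambda>) z = R"
    unfolding resolvent_def A_def[symmetric] using inv_into_f_eq[OF inj RD AR] by blast
  ultimately show "z \<in> resolvent_set (pair_domain I u v \<Lambda>) (pair_operator I u v \<Lambda>)"
    and "((\<lambda>\<xi>. (1 / (\<Lambda> \<xi> - z) * cinner f (v \<xi>)) *\<^sub>C u \<xi>) has_sum
      resolvent (pair_domain I u v \<Lambda>) (pair_operator I u v \<Lambda>) z f) I"
    using inj R sums unfolding D_def A_def by (simp_all add: resolvent_set_def bij_betw_def)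
qed


section \<open>Series of distributions\<close>

lemma subspace_test_space: "complex_vector.subspace (test_space I u \<Lambda>)"
proof (rule complex_vector.subspaceI)
  show "0 \<in> test_space I u \<Lambda>"
    by (auto simp: test_space_def intro!: exI[of _ 0])
next
  fix \<phi> \<psi>
  assume mem: "\<phi> \<in> test_space I u \<Lambda>" "\<psi> \<in> test_space I u \<Lambda>"
  show "\<phi> + \<psi> \<in> test_space I u \<Lambda>"
    unfolding test_space_def
  proof (intro CollectI allI)
    fix k
    obtain C C' where "\<forall>\<xi>\<in>I. cmod (cinner \<phi> (u \<xi>)) \<le> C * inverse ((1 + cmod (\<Lambda> \<xi>)) ^ k)"
      and "\<forall>\<xi>\<in>I. cmod (cinner \<psi> (u \<xi>)) \<le> C' * inverse ((1 + cmod (\<Lambda> \<xi>)) ^ k)"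
      using mem unfolding test_space_def by blast
    then have "\<forall>\<xi>\<in>I. cmod (cinner (\<phi> + \<psi>) (u \<xi>)) \<le> (C + C') * inverse ((1 + cmod (\<Lambda> \<xi>)) ^ k)"
      unfolding cinner_add_left distrib_right by (blast intro: norm_triangle_mono)
    then show "\<exists>C. \<forall>\<xi>\<in>I. cmod (cinner (\<phi> + \<psi>) (u \<xi>)) \<le> C * inverse ((1 + cmod (\<Lambda> \<xi>)) ^ k)" ..
  qed
next
  fix c \<psi>
  assume mem: "\<psi> \<in> test_space I u \<Lambda>"
  show "c *\<^sub>C \<psi> \<in> test_space I u \<Lambda>"
    unfolding test_space_def
  proof (intro CollectI allI)
    fix k
    obtain C where "\<forall>\<xi>\<in>I. cmod (cinner \<psi> (u \<xi>)) \<le> C * inverse ((1 + cmod (\<Lambda> \<xi>)) ^ k)"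
      using mem unfolding test_space_def by blast
    then have "\<forall>\<xi>\<in>I. cmod (cinner (c *\<^sub>C \<psi>) (u \<xi>)) \<le> (cmod c * C) * inverse ((1 + cmod (\<Lambda> \<xi>)) ^ k)"
      by (simp add: cinner_scaleC_left norm_mult mult.assoc mult_left_mono)
    then show "\<exists>C. \<forall>\<xi>\<in>I. cmod (cinner (c *\<^sub>C \<psi>) (u \<xi>)) \<le> C * inverse ((1 + cmod (\<Lambda> \<xi>)) ^ k)" ..
  qed
qed

text \<open>A real supremum dominates its members only for sets bounded above; the decay estimate of
  order \<open>k\<close> supplies the bound.\<close>

lemma le_test_seminorm:
  assumes "\<psi> \<in> test_space I u \<Lambda>" and "\<xi> \<in> I"
  shows "(1 + cmod (\<Lambda> \<xi>)) ^ k * cmod (cinner \<psi> (u \<xi>)) \<le> test_seminorm I u \<Lambda> k \<psi>"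
  unfolding test_seminorm_def
proof (rule cSUP_upper[OF assms(2)])
  obtain C where C: "\<forall>\<xi>\<in>I. cmod (cinner \<psi> (u \<xi>)) \<le> C * inverse ((1 + cmod (\<Lambda> \<xi>)) ^ k)"
    using assms(1) unfolding test_space_def by blast
  show "bdd_above ((\<lambda>\<xi>. (1 + cmod (\<Lambda> \<xi>)) ^ k * cmod (cinner \<psi> (u \<xi>))) ` I)"
  proof (rule bdd_aboveI2)
    fix \<eta> assume "\<eta> \<in> I"
    then have "cmod (cinner \<psi> (u \<eta>)) \<le> C / (1 + cmod (\<Lambda> \<eta>)) ^ k"
      using C by (simp only: divide_inverse)
    moreover have "(1 + cmod (\<Lambda> \<eta>)) ^ k > 0"
      by (simp add: add_pos_nonneg)
    ultimately show "(1 + cmod (\<Lambda> \<eta>)) ^ k * cmod (cinner \<psi> (u \<eta>)) \<le> C"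
      by (simp only: pos_le_divide_eq mult.commute)
  qed
qed

lemma topspace_test_topology: "topspace (test_topology I u \<Lambda>) = test_space I u \<Lambda>"
proof
  show "topspace (test_topology I u \<Lambda>) \<subseteq> test_space I u \<Lambda>"
    unfolding test_topology_def topology_generated_by_topspace by blast
  show "test_space I u \<Lambda> \<subseteq> topspace (test_topology I u \<Lambda>)"
  proof
    fix \<psi> assume mem: "\<psi> \<in> test_space I u \<Lambda>"
    \<comment> \<open>The radius exceeds the seminorm of \<open>\<psi> - \<psi>\<close>, whatever
      its value, so empty \<open>I\<close> is included.\<close>
    define \<epsilon> where "\<epsilon> = \<bar>test_seminorm I u \<Lambda> 0 0\<bar> + 1"
    have "\<epsilon> > 0" and "\<psi> \<in> {\<psi>' \<in> test_space I u \<Lambda>. test_seminorm I u \<Lambda> 0 (\<psi>' - \<psi>) < \<epsilon>}"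
      using mem by (simp_all add: \<epsilon>_def)
    then show "\<psi> \<in> topspace (test_topology I u \<Lambda>)"
      unfolding test_topology_def topology_generated_by_topspace using mem by blast
  qed
qed

(* For empty I the seminorms are the unspecified constant Sup {}, not 0. *)
lemma distributionsI:
  assumes "I \<noteq> {}" and "w \<in> extensional (test_space I u \<Lambda>)"
    and add: "\<And>\<phi> \<psi>. \<phi> \<in> test_space I u \<Lambda> \<Longrightarrow> \<psi> \<in> test_space I u \<Lambda> \<Longrightarrow> w (\<phi> + \<psi>) = w \<phi> + w \<psi>"
    and "\<And>c \<psi>. \<psi> \<in> test_space I u \<Lambda> \<Longrightarrow> w (c *\<^sub>C \<psi>) = cnj c * w \<psi>"
    and bound: "\<And>\<psi>. \<psi> \<in> test_space I u \<Lambda> \<Longrightarrow> cmod (w \<psi>) \<le> K * test_seminorm I u \<Lambda> k \<psi>"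
  shows "w \<in> distributions I u \<Lambda>"
proof -
  let ?T = "test_space I u \<Lambda>" and ?p = "test_seminorm I u \<Lambda> k"
  have "openin (test_topology I u \<Lambda>) {\<phi> \<in> topspace (test_topology I u \<Lambda>). w \<phi> \<in> U}" if "open U" for U
  proof (subst openin_subopen, intro ballI)
    fix \<phi> assume "\<phi> \<in> {\<phi> \<in> topspace (test_topology I u \<Lambda>). w \<phi> \<in> U}"
    then have \<phi>: "\<phi> \<in> ?T" "w \<phi> \<in> U"
      by (auto simp: topspace_test_topology)
    obtain \<epsilon> where \<epsilon>: "\<epsilon> > 0" "\<And>y. dist y (w \<phi>) < \<epsilon> \<Longrightarrow> y \<in> U"
      using \<open>open U\<close> \<phi>(2) unfolding open_dist by blast
    \<comment> \<open>Adding 1 to the absolute value of \<open>K\<close> makes the divisor positive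
      for every real \<open>K\<close>.\<close>
    define \<delta> where "\<delta> = \<epsilon> / (\<bar>K\<bar> + 1)"
    define N where "N = {\<psi> \<in> ?T. ?p (\<psi> - \<phi>) < \<delta>}"
    have "\<delta> > 0"
      using \<epsilon>(1) by (simp add: \<delta>_def)
    then have "openin (test_topology I u \<Lambda>) N"
      unfolding test_topology_def N_def using \<phi>(1) by (intro topology_generated_by_Basis) blast
    moreover have "\<phi> \<in> N"
      using \<phi>(1) \<open>\<delta> > 0\<close> \<open>I \<noteq> {}\<close> by (simp add: N_def test_seminorm_def)
    moreover have "w \<psi> \<in> U" if "\<psi> \<in> N" for \<psi>
    proof (rule \<epsilon>(2))
      have \<psi>: "\<psi> \<in> ?T" "?p (\<psi> - \<phi>) < \<delta>"
        using that by (auto simp: N_def)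
      have diff: "\<psi> - \<phi> \<in> ?T"
        using subspace_test_space \<psi>(1) \<phi>(1) by (rule complex_vector.subspace_diff)
      obtain \<xi> where "\<xi> \<in> I"
        using \<open>I \<noteq> {}\<close> by blast
      have "0 \<le> (1 + cmod (\<Lambda> \<xi>)) ^ k * cmod (cinner (\<psi> - \<phi>) (u \<xi>))"
        by simp
      also have "\<dots> \<le> ?p (\<psi> - \<phi>)"
        by (rule le_test_seminorm[OF diff \<open>\<xi> \<in> I\<close>])
      finally have nonneg: "0 \<le> ?p (\<psi> - \<phi>)" .
      \<comment> \<open>Additivity reduces continuity at \<open>\<phi>\<close> to the seminorm bound
        at the difference.\<close>
      have "dist (w \<psi>) (w \<phi>) = cmod (w (\<psi> - \<phi>))"
        using add[OF diff \<phi>(1)] by (simp add: dist_norm)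
      also have "\<dots> \<le> K * ?p (\<psi> - \<phi>)"
        by (rule bound[OF diff])
      also have "\<dots> \<le> (\<bar>K\<bar> + 1) * ?p (\<psi> - \<phi>)"
        using nonneg by (intro mult_right_mono) auto
      also have "\<dots> < (\<bar>K\<bar> + 1) * \<delta>"
        using \<psi>(2) by (intro mult_strict_left_mono) auto
      also have "\<dots> = \<epsilon>"
        by (simp add: \<delta>_def)
      finally show "dist (w \<psi>) (w \<phi>) < \<epsilon>" .
    qed
    ultimately show "\<exists>N. openin (test_topology I u \<Lambda>) N \<and> \<phi> \<in> N \<and>
        N \<subseteq> {\<phi> \<in> topspace (test_topology I u \<Lambda>). w \<phi> \<in> U}"
      by (intro exI[of _ N]) (auto simp: N_def topspace_test_topology)
  qed
  then have "continuous_map (test_topology I u \<Lambda>) euclidean w"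
    by (simp add: continuous_map_def)
  then show ?thesis
    using assms(2-4) by (simp add: distributions_def)
qed

section \<open>Weak-star convergence of series\<close>

text \<open>The decay of a test function against \<open>u\<close> dominates the terms by a multiple
  of the given summable family. The second bound yields continuity of the sum.\<close>

lemma test_series_bound:
  assumes "(\<lambda>\<xi>. (1 + cmod (\<Lambda> \<xi>)) powr (- s)) summable_on I"
    and "\<And>\<xi>. \<xi> \<in> I \<Longrightarrow> cmod (c \<xi>) \<le> M" and "\<psi> \<in> test_space I u \<Lambda>"
  shows "(\<lambda>\<xi>. c \<xi> * cinner (u \<xi>) \<psi>) summable_on I"
    and "cmod (\<Sum>\<^sub>\<infinity>\<xi>\<in>I. c \<xi> * cinner (u \<xi>) \<psi>)
      \<le> (M * (\<Sum>\<^sub>\<infinity>\<xi>\<in>I. (1 + cmod (\<Lambda> \<xi>)) powr (- s))) * test_seminorm I u \<Lambda> (nat \<lceil>s\<rceil>) \<psi>"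
proof -
  \<comment> \<open>The seminorms have natural order, so \<open>s\<close> is rounded up; bases at
    least 1 make the larger exponent harmless.\<close>
  define k where "k = nat \<lceil>s\<rceil>"
  let ?p = "test_seminorm I u \<Lambda> k \<psi>"
  have le: "cmod (c \<xi> * cinner (u \<xi>) \<psi>) \<le> (M * ?p) * (1 + cmod (\<Lambda> \<xi>)) powr (- s)" if "\<xi> \<in> I" for \<xi>
  proof -
    have "1 + cmod (\<Lambda> \<xi>) > 0"
      by (simp add: add_pos_nonneg)
    then have "cmod (cinner (u \<xi>) \<psi>) = ((1 + cmod (\<Lambda> \<xi>)) ^ k * cmod (cinner \<psi> (u \<xi>))) * (1 + cmod (\<Lambda> \<xi>)) powr (- real k)"
      by (simp add: cmod_cinner_commute[of "u \<xi>"] powr_minus powr_realpow field_simps)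
    also have "\<dots> \<le> ?p * (1 + cmod (\<Lambda> \<xi>)) powr (- s)"
    proof (rule mult_mono[OF le_test_seminorm[OF assms(3) that]])
      show "(1 + cmod (\<Lambda> \<xi>)) powr (- real k) \<le> (1 + cmod (\<Lambda> \<xi>)) powr (- s)"
        unfolding k_def by (intro powr_mono) (linarith | simp)+
      show "0 \<le> ?p"
        using le_test_seminorm[OF assms(3) that, of k] by (rule order_trans[rotated]) simp
    qed simp
    finally have "cmod (cinner (u \<xi>) \<psi>) \<le> ?p * (1 + cmod (\<Lambda> \<xi>)) powr (- s)" .
    moreover have "0 \<le> M"
      using assms(2)[OF that] norm_ge_zero order_trans by blast
    ultimately have "cmod (c \<xi>) * cmod (cinner (u \<xi>) \<psi>) \<le> M * (?p * (1 + cmod (\<Lambda> \<xi>)) powr (- s))"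
      using assms(2)[OF that] by (intro mult_mono) auto
    then show ?thesis
      by (simp add: norm_mult mult.assoc)
  qed
  have dom: "(\<lambda>\<xi>. (M * ?p) * (1 + cmod (\<Lambda> \<xi>)) powr (- s)) summable_on I"
    by (rule summable_on_cmult_right[OF assms(1)])
  show summ: "(\<lambda>\<xi>. c \<xi> * cinner (u \<xi>) \<psi>) summable_on I"
    by (rule abs_summable_summable, rule Infinite_Sum.abs_summable_on_comparison_test'[OF dom le])
  have "cmod (\<Sum>\<^sub>\<infinity>\<xi>\<in>I. c \<xi> * cinner (u \<xi>) \<psi>) \<le> (\<Sum>\<^sub>\<infinity>\<xi>\<in>I. (M * ?p) * (1 + cmod (\<Lambda> \<xi>)) powr (- s))"
    by (rule norm_infsum_le[OF has_sum_infsum[OF summ] has_sum_infsum[OF dom] le])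
  also have "\<dots> = (M * (\<Sum>\<^sub>\<infinity>\<xi>\<in>I. (1 + cmod (\<Lambda> \<xi>)) powr (- s))) * ?p"
    by (simp add: infsum_cmult_right')
  finally show "cmod (\<Sum>\<^sub>\<infinity>\<xi>\<in>I. c \<xi> * cinner (u \<xi>) \<psi>)
      \<le> (M * (\<Sum>\<^sub>\<infinity>\<xi>\<in>I. (1 + cmod (\<Lambda> \<xi>)) powr (- s))) * test_seminorm I u \<Lambda> (nat \<lceil>s\<rceil>) \<psi>"
    by (simp only: k_def)
qed

text \<open>An explicit candidate for the weak-star sum, later identified with the
  \<open>THE\<close> in \<open>resolvent_kernel\<close>.\<close>

definition distr_series ::
  "'i set \<Rightarrow> ('i \<Rightarrow> 'a::complex_inner) \<Rightarrow> ('i \<Rightarrow> complex) \<Rightarrow> ('i \<Rightarrow> complex) \<Rightarrow> 'a \<Rightarrow> complex"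
  where "distr_series I u \<Lambda> c = (\<lambda>\<psi>\<in>test_space I u \<Lambda>. \<Sum>\<^sub>\<infinity>\<xi>\<in>I. c \<xi> * cinner (u \<xi>) \<psi>)"

lemma distr_series_in_distributions:
  assumes "(\<lambda>\<xi>. (1 + cmod (\<Lambda> \<xi>)) powr (- s)) summable_on I"
    and "\<And>\<xi>. \<xi> \<in> I \<Longrightarrow> cmod (c \<xi>) \<le> M"
  shows "distr_series I u \<Lambda> c \<in> distributions I u \<Lambda>"
proof (cases "I = {}")
  \<comment> \<open>The functional vanishes on the test space, so continuity is immediate without a
    seminorm bound.\<close>
  case True
  have "continuous_map (test_topology I u \<Lambda>) euclidean (distr_series I u \<Lambda> c)"
    by (rule continuous_map_eq[of _ _ "\<lambda>_. 0"])
      (simp_all add: True topspace_test_topology[where I = "{}"] distr_series_def)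
  then show ?thesis
    using subspace_test_space[of I u \<Lambda>]
    by (simp add: True distributions_def distr_series_def complex_vector.subspace_def)
next
  case False
  show ?thesis
  proof (rule distributionsI[OF False])
    show "distr_series I u \<Lambda> c \<in> extensional (test_space I u \<Lambda>)"
      by (simp add: distr_series_def)
  next
    fix \<phi> \<psi> assume mem: "\<phi> \<in> test_space I u \<Lambda>" "\<psi> \<in> test_space I u \<Lambda>"
    then show "distr_series I u \<Lambda> c (\<phi> + \<psi>) = distr_series I u \<Lambda> c \<phi> + distr_series I u \<Lambda> c \<psi>"
      using infsum_add[OF test_series_bound(1)[OF assms mem(1)] test_series_bound(1)[OF assms mem(2)]]
        complex_vector.subspace_add[OF subspace_test_space mem]
      by (simp add: distr_series_def cinner_add_right distrib_left)
  next
    fix a \<psi> assume mem: "\<psi> \<in> test_space I u \<Lambda>"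
    then show "distr_series I u \<Lambda> c (a *\<^sub>C \<psi>) = cnj a * distr_series I u \<Lambda> c \<psi>"
      using complex_vector.subspace_scale[OF subspace_test_space mem]
      by (simp add: distr_series_def cinner_scaleC_right mult.left_commute infsum_cmult_right')
  next
    fix \<psi> assume "\<psi> \<in> test_space I u \<Lambda>"
    then show "cmod (distr_series I u \<Lambda> c \<psi>)
      \<le> (M * (\<Sum>\<^sub>\<infinity>\<xi>\<in>I. (1 + cmod (\<Lambda> \<xi>)) powr (- s))) * test_seminorm I u \<Lambda> (nat \<lceil>s\<rceil>) \<psi>"
      using test_series_bound(2)[OF assms] by (simp add: distr_series_def)
  qed
qed

text \<open>Partial sums become series with truncated coefficients, so their continuity is an
  instance of \<open>distr_series_in_distributions\<close>.\<close>

lemma embed_distr_finite_sum: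
  assumes "finite F" and "F \<subseteq> I"
  shows "embed_distr I u \<Lambda> (\<Sum>\<xi>\<in>F. c \<xi> *\<^sub>C u \<xi>) = distr_series I u \<Lambda> (\<lambda>\<xi>. if \<xi> \<in> F then c \<xi> else 0)"
proof -
  have "(\<Sum>\<^sub>\<infinity>\<xi>\<in>I. (if \<xi> \<in> F then c \<xi> else 0) * cinner (u \<xi>) \<psi>) = cinner (\<Sum>\<xi>\<in>F. c \<xi> *\<^sub>C u \<xi>) \<psi>" for \<psi>
    by (rule infsumI, rule has_sum_finite_neutralI[OF assms])
      (simp_all add: cinner_sum_left cinner_scaleC_left)
  then show ?thesis
    by (simp add: embed_distr_def distr_series_def)
qed

lemma has_distr_sum_distr_series:
  assumes "(\<lambda>\<xi>. (1 + cmod (\<Lambda> \<xi>)) powr (- s)) summable_on I"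
    and "\<And>\<xi>. \<xi> \<in> I \<Longrightarrow> cmod (c \<xi>) \<le> M"
  shows "has_distr_sum I u \<Lambda> c (distr_series I u \<Lambda> c)"
  unfolding has_distr_sum_def weak_star_topology_def limitin_subtopology limitin_componentwise
proof (intro conjI ballI)
  show "distr_series I u \<Lambda> c \<in> distributions I u \<Lambda>"
    by (rule distr_series_in_distributions[OF assms])
  show "\<forall>\<^sub>F F in finite_subsets_at_top I.
      embed_distr I u \<Lambda> (\<Sum>\<xi>\<in>F. c \<xi> *\<^sub>C u \<xi>) \<in> distributions I u \<Lambda>"
  proof (rule eventually_finite_subsets_at_top_weakI)
    fix F assume F: "finite F" "F \<subseteq> I"
    have "cmod (if \<xi> \<in> F then c \<xi> else 0) \<le> \<bar>M\<bar>" if "\<xi> \<in> I" for \<xi>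
      using assms(2)[OF that] by auto
    then show "embed_distr I u \<Lambda> (\<Sum>\<xi>\<in>F. c \<xi> *\<^sub>C u \<xi>) \<in> distributions I u \<Lambda>"
      unfolding embed_distr_finite_sum[OF F] by (rule distr_series_in_distributions[OF assms(1)])
  qed
  show "distr_series I u \<Lambda> c \<in> extensional (test_space I u \<Lambda>)"
    by (simp add: distr_series_def)
  show "\<forall>\<^sub>F F in finite_subsets_at_top I. embed_distr I u \<Lambda> (\<Sum>\<xi>\<in>F. c \<xi> *\<^sub>C u \<xi>)
      \<in> topspace (product_topology (\<lambda>_. euclidean) (test_space I u \<Lambda>))"
    by (simp add: embed_distr_def)
next
  fix \<psi> assume \<psi>: "\<psi> \<in> test_space I u \<Lambda>"
  then show "limitin euclidean (\<lambda>F. embed_distr I u \<Lambda> (\<Sum>\<xi>\<in>F. c \<xi> *\<^sub>C u \<xi>) \<psi>)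
      (distr_series I u \<Lambda> c \<psi>) (finite_subsets_at_top I)"
    using infsum_tendsto[OF test_series_bound(1)[OF assms \<psi>]]
    by (simp add: embed_distr_def distr_series_def cinner_sum_left cinner_scaleC_left)
qed

text \<open>The weak-star topology is Hausdorff as a subspace of a product of Hausdorff spaces; this
  justifies the \<open>THE\<close> in \<open>resolvent_kernel\<close>.\<close>

lemma has_distr_sum_unique:
  assumes "has_distr_sum I u \<Lambda> c w" and "has_distr_sum I u \<Lambda> c w'"
  shows "w = w'"
  using assms unfolding has_distr_sum_def weak_star_topology_def
  by (rule limitin_Hausdorff_unique)
    (simp_all add: Hausdorff_space_subtopology Hausdorff_space_product_topology)

section \<open>Fourier coefficients of distributions\<close>

text \<open>Distributions are \<open>undefined\<close> off the test space, so their Fourier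
  coefficients are meaningful only by this fact. A single coefficient of \<open>v \<eta>\<close> is
  nonzero, and it fixes the constant.\<close>

lemma biorthogonal_in_test_space:
  assumes "biorthogonal I u v" and "\<eta> \<in> I"
  shows "v \<eta> \<in> test_space I u \<Lambda>"
proof -
  have "cmod (cinner (v \<eta>) (u \<xi>)) \<le> (1 + cmod (\<Lambda> \<eta>)) ^ k * inverse ((1 + cmod (\<Lambda> \<xi>)) ^ k)"
    if "\<xi> \<in> I" for \<xi> k
  proof (cases "\<xi> = \<eta>")
    case True
    have "1 + cmod (\<Lambda> \<eta>) \<noteq> 0"
      using norm_ge_zero[of "\<Lambda> \<eta>"] by linarith
    then show ?thesis
      using assms True by (simp add: cmod_cinner_commute[of "v \<eta>"] biorthogonal_def)
  next
    case False
    then show ?thesis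
      using assms that by (simp add: cmod_cinner_commute[of "v \<eta>"] biorthogonal_def)
  qed
  then show ?thesis
    unfolding test_space_def by blast
qed

lemma fourier_coeff_distr_series:
  assumes "biorthogonal I u v" and "\<eta> \<in> I"
  shows "fourier_coeff v (distr_series I u \<Lambda> c) \<eta> = c \<eta>"
proof -
  have "((\<lambda>\<xi>. c \<xi> * cinner (u \<xi>) (v \<eta>)) has_sum c \<eta>) I"
    by (rule has_sum_finite_neutralI[of "{\<eta>}"]) (use assms in \<open>auto simp: biorthogonal_def\<close>)
  then show ?thesis
    using biorthogonal_in_test_space[OF assms]
    by (simp add: fourier_coeff_def distr_series_def infsumI)
qed

lemma fourier_coeff_embed_distr:
  assumes "biorthogonal I u v" and "\<eta> \<in> I"
  shows "fourier_coeff v (embed_distr I u \<Lambda> f) \<eta> = cinner f (v \<eta>)"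
  using biorthogonal_in_test_space[OF assms] by (simp add: fourier_coeff_def embed_distr_def)


section \<open>The resolvent\<close>

text \<open>Only the finitely many indices in \<open>B\<close> have \<open>\<Lambda> \<xi>\<close>
  possibly closer to \<open>z\<close> than 1.\<close>

lemma resolvent_coefficients_bounded:
  fixes \<Lambda> :: "'i \<Rightarrow> complex"
  assumes "s > 0" and "(\<lambda>\<xi>. (1 + cmod (\<Lambda> \<xi>)) powr (- s)) summable_on I" and "z \<notin> \<Lambda> ` I"
  obtains M where "\<And>\<xi>. \<xi> \<in> I \<Longrightarrow> cmod (1 / (\<Lambda> \<xi> - z)) \<le> M"
proof
  define B where "B = {\<xi> \<in> I. cmod (\<Lambda> \<xi>) < cmod z + 1}"
  have "(\<lambda>\<xi>. (1 + cmod (\<Lambda> \<xi>)) powr (- s)) summable_on B"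
    by (rule summable_on_subset_banach[OF assms(2)]) (auto simp: B_def)
  \<comment> \<open>On \<open>B\<close> each term is at least this positive constant, and a summable
    positive constant forces a finite index set.\<close>
  then have "(\<lambda>_. (cmod z + 2) powr (- s)) summable_on B"
    by (rule summable_on_comparison_test)
      (use assms(1) in \<open>auto simp: B_def intro!: powr_mono2' add_pos_nonneg\<close>)
  moreover have "(cmod z + 2) powr (- s) > 0"
    using norm_ge_zero[of z] by (simp add: add_nonneg_eq_0_iff)
  ultimately have fin: "finite B"
    using infsum_diverge_constant[of B "(cmod z + 2) powr (- s)"] by auto
  fix \<xi> assume "\<xi> \<in> I"
  \<comment> \<open>This is the witness for \<open>M\<close>: 1 serves the indices outside
    \<open>B\<close>, and the sum stands in for a maximum over \<open>B\<close>, also when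
    \<open>B\<close> is empty.\<close>
  show "cmod (1 / (\<Lambda> \<xi> - z)) \<le> 1 + (\<Sum>\<eta>\<in>B. cmod (1 / (\<Lambda> \<eta> - z)))"
  proof (cases "\<xi> \<in> B")
    case True
    then have "cmod (1 / (\<Lambda> \<xi> - z)) \<le> (\<Sum>\<eta>\<in>B. cmod (1 / (\<Lambda> \<eta> - z)))"
      by (intro member_le_sum fin) auto
    then show ?thesis by simp
  next
    case False
    then have "1 \<le> cmod (\<Lambda> \<xi> - z)"
      using \<open>\<xi> \<in> I\<close> norm_triangle_ineq2[of "\<Lambda> \<xi>" z] by (simp add: B_def)
    then have "cmod (1 / (\<Lambda> \<xi> - z)) \<le> 1"
      by (simp add: norm_divide divide_le_eq_1)
    moreover have "0 \<le> (\<Sum>\<eta>\<in>B. cmod (1 / (\<Lambda> \<eta> - z)))"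
      by (simp add: sum_nonneg)
    ultimately show ?thesis by linarith
  qed
qed

text \<open>The clauses besides the formula exclude default values: the kernel is a genuine
  weak-star limit, the resolvent a genuine bounded inverse, and the convolution a convergent
  series.\<close>

theorem theorem4p5:
  fixes I :: "'i set"
    and u v :: "'i \<Rightarrow> 'a::complex_hilbert"
    and \<Lambda> :: "'i \<Rightarrow> complex"
    and s\<^sub>0 :: real
    and z :: complex
  assumes "separable_space (euclidean :: 'a topology)"
    and "countable I"
    and "riesz_basis I u"
    and "biorthogonal I u v"
    and "s\<^sub>0 > 0"
    and "(\<lambda>\<xi>. (1 + cmod (\<Lambda> \<xi>)) powr (- s\<^sub>0)) summable_on I"
    and "z \<notin> \<Lambda> ` I"
  shows "has_distr_sum I u \<Lambda> (\<lambda>\<xi>. 1 / (\<Lambda> \<xi> - z)) (resolvent_kernel I u \<Lambda> z) \<and>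
    z \<in> resolvent_set (pair_domain I u v \<Lambda>) (pair_operator I u v \<Lambda>) \<and>
    (\<forall>f. convolvable I u v (resolvent_kernel I u \<Lambda> z) (embed_distr I u \<Lambda> f) \<and>
      resolvent (pair_domain I u v \<Lambda>) (pair_operator I u v \<Lambda>) z f =
        convolution I u v (resolvent_kernel I u \<Lambda> z) (embed_distr I u \<Lambda> f))"
proof -
  let ?c = "\<lambda>\<xi>. 1 / (\<Lambda> \<xi> - z)"
  obtain M where M: "\<And>\<xi>. \<xi> \<in> I \<Longrightarrow> cmod (?c \<xi>) \<le> M"
    using resolvent_coefficients_bounded[OF assms(5-7)] by blast
  have sum: "has_distr_sum I u \<Lambda> ?c (distr_series I u \<Lambda> ?c)"
    by (rule has_distr_sum_distr_series[OF assms(6) M])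
  then have kernel: "resolvent_kernel I u \<Lambda> z = distr_series I u \<Lambda> ?c"
    unfolding resolvent_kernel_def using has_distr_sum_unique by blast
  \<comment> \<open>Once the Fourier coefficients are evaluated, this is the multiplier series of
    the resolvent.\<close>
  have series: "((\<lambda>\<xi>. (fourier_coeff v (resolvent_kernel I u \<Lambda> z) \<xi> *
        fourier_coeff v (embed_distr I u \<Lambda> f) \<xi>) *\<^sub>C u \<xi>) has_sum
      resolvent (pair_domain I u v \<Lambda>) (pair_operator I u v \<Lambda>) z f) I" for f
    using pair_operator_resolvent(2)[OF assms(3,4,7) M, of f]
    by (simp add: kernel fourier_coeff_distr_series[OF assms(4)] fourier_coeff_embed_distr[OF assms(4)]
        cong: has_sum_cong)
  show ?thesis
  proof (intro conjI allI)
    show "has_distr_sum I u \<Lambda> ?c (resolvent_kernel I u \<Lambda> z)"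
      using sum by (simp only: kernel)
    show "z \<in> resolvent_set (pair_domain I u v \<Lambda>) (pair_operator I u v \<Lambda>)"
      by (rule pair_operator_resolvent(1)[OF assms(3,4,7) M])
    fix f
    show "convolvable I u v (resolvent_kernel I u \<Lambda> z) (embed_distr I u \<Lambda> f)"
      unfolding convolvable_def by (rule has_sum_imp_summable[OF series])
    show "resolvent (pair_domain I u v \<Lambda>) (pair_operator I u v \<Lambda>) z f =
        convolution I u v (resolvent_kernel I u \<Lambda> z) (embed_distr I u \<Lambda> f)"
      unfolding convolution_def by (rule infsumI[OF series, symmetric])
  qed
qed

end
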